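(* Let $M$ be a commutative partial monoid and let $L\in M$ be any element. For $n\ge0$ let $$\hat N_n^LM=\{(x_0,\dots,x_n)\in M^{n+1}\mid x_0\cdots x_n\text{ is defined and equal to }L\},$$ and for a map $f:[m]\to[n]$ let $f_*:\hat N_m^LM\to\hat N_n^LM$ be $f_*(x_0,\dots,x_m)=(y_0,\dots,y_n)$ with $y_i=\prod_{j\in f^{-1}(i)}x_j$. Then $\hat N_\bullet^LM$ (the $L$-simplex set of $M$) is a cosymmetric set, i.e. a functor $\Phi\to\mathbf{Set}$, and it is $2$-Segal.
   Context: A *partial monoid* is a set $M$ with a partially defined operation $M_2\to M$, $(x,y)\mapsto x\cdot y$, $M_2\subseteq M\times M$, such that $(x\cdot y)\cdot z=x\cdot(y\cdot z)$ for all $x,y,z\in M$, and there is $e\in M$ with $e\cdot x=x\cdot e=x$ for all $x$; equalities mean that either both sides are defined and equal or both are undefined. It is commutative if $x\cdot y=y\cdot x$ for all $x,y$ in the same sense. Empty products are $e$. Write $[n]=\{0,1,\dots,n\}$. $\Phi$ is the full subcategory of $\mathbf{Set}$ on the objects $[n]$, $n\ge0$; a cosymmetric set is a functor $X_\bullet:\Phi\to\mathbf{Set}$. Its underlying simplicial set has face and degeneracy maps induced by the following maps in $\Phi$: for $0\le i<n$, $d_i^n:[n]\to[n-1]$ with $k\mapsto k$ for $k\le i$, $k\mapsto k-1$ for $k>i$; $d_n^n:[n]\to[n-1]$ with $k\mapsto k$ for $k<n$, $n\mapsto0$; $s_i^n:[n]\to[n+1]$ ($0\le i\le n$) with $k\mapsto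 k$ for $k\le i$, $k\mapsto k+1$ for $k>i$. A simplicial (or cosymmetric) set $X_\bullet$ is *$2$-Segal* if for all $0<i<n$ the maps $(d_{i+1},d_0):X_{n+1}\to X_n\times_{d_0,X_{n-1},d_i}X_n$ and $(d_i,d_{n+1}):X_{n+1}\to X_n\times_{d_n,X_{n-1},d_i}X_n$ are bijections. *)

theory Defs
  imports Main "HOL-Library.FuncSet"
begin

text \<open>
  The partial operation is \<open>'a option\<close>-valued, with \<open>None\<close> for ``undefined''. Hence equality of
  options is exactly ``both sides defined and equal, or both undefined''. Only the values of
  \<open>mul\<close> on \<open>M \<times> M\<close> matter.
\<close>

locale partial_monoid =
  fixes M :: "'a set" and mul :: "'a \<Rightarrow> 'a \<Rightarrow> 'a option" and e :: 'a
  assumes mul_closed: "\<lbrakk>x \<in> M; y \<in> M; mul x y = Some z\<rbrakk> \<Longrightarrow> z \<in> M"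
    and mul_assoc: "\<lbrakk>x \<in> M; y \<in> M; z \<in> M\<rbrakk> \<Longrightarrow>
      Option.bind (mul x y) (\<lambda>u. mul u z) = Option.bind (mul y z) (\<lambda>v. mul x v)"
    and unit_closed: "e \<in> M"
    and unit_left: "x \<in> M \<Longrightarrow> mul e x = Some x"
    and unit_right: "x \<in> M \<Longrightarrow> mul x e = Some x"

locale comm_partial_monoid = partial_monoid +
  assumes mul_comm: "\<lbrakk>x \<in> M; y \<in> M\<rbrakk> \<Longrightarrow> mul x y = mul y x"

fun pprod :: "('a \<Rightarrow> 'a \<Rightarrow> 'a option) \<Rightarrow> 'a \<Rightarrow> 'a list \<Rightarrow> 'a option" where
  "pprod mul e [] = Some e"
| "pprod mul e (x # xs) = Option.bind (pprod mul e xs) (\<lambda>v. mul x v)"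

text \<open>
  The category \<open>\<Phi>\<close>: the object \<open>[n]\<close> is \<open>{..n}\<close>, and morphisms are extensional functions, so
  that equality of morphisms is equality in HOL. Maps between the sets of a cosymmetric set are
  likewise extensional, so the functor laws are plain equations.
\<close>

definition Phi_hom :: "nat \<Rightarrow> nat \<Rightarrow> (nat \<Rightarrow> nat) set" where
  "Phi_hom m n = {..m} \<rightarrow>\<^sub>E {..n}"

definition cosymmetric_set ::
  "(nat \<Rightarrow> 'b set) \<Rightarrow> (nat \<Rightarrow> nat \<Rightarrow> (nat \<Rightarrow> nat) \<Rightarrow> 'b \<Rightarrow> 'b) \<Rightarrow> bool" where
  "cosymmetric_set X F \<longleftrightarrow>
     (\<forall>m n. \<forall>f\<in>Phi_hom m n. F m n f \<in> X m \<rightarrow>\<^sub>E X n) \<and>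
     (\<forall>n. F n n (\<lambda>k\<in>{..n}. k) = (\<lambda>x\<in>X n. x)) \<and>
     (\<forall>l m n. \<forall>f\<in>Phi_hom l m. \<forall>g\<in>Phi_hom m n.
        F l n (compose {..l} g f) = compose (X l) (F m n g) (F l m f))"

text \<open>The map \<open>d_i^n : [n] \<rightarrow> [n-1]\<close> of \<open>\<Phi>\<close>, for \<open>n \<ge> 1\<close> and \<open>i \<le> n\<close>.\<close>

definition Phi_face :: "nat \<Rightarrow> nat \<Rightarrow> nat \<Rightarrow> nat" where
  "Phi_face n i =
     (\<lambda>k\<in>{..n}. if i < n then (if k \<le> i then k else k - 1) else (if k < n then k else 0))"

definition face ::
  "(nat \<Rightarrow> nat \<Rightarrow> (nat \<Rightarrow> nat) \<Rightarrow> 'b \<Rightarrow> 'b) \<Rightarrow> nat \<Rightarrow> nat \<Rightarrow> 'b \<Rightarrow> 'b" where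
  "face F n i = F n (n - 1) (Phi_face n i)"

text \<open>
  The 2-Segal condition involves only the face maps, \<open>d n i : X n \<rightarrow> X (n - 1)\<close>, of a simplicial set.
\<close>

definition two_segal ::
  "(nat \<Rightarrow> 'b set) \<Rightarrow> (nat \<Rightarrow> nat \<Rightarrow> 'b \<Rightarrow> 'b) \<Rightarrow> bool" where
  "two_segal X d \<longleftrightarrow> (\<forall>n i. 0 < i \<and> i < n \<longrightarrow>
     bij_betw (\<lambda>x. (d (n + 1) (i + 1) x, d (n + 1) 0 x)) (X (n + 1))
       {(a, b). a \<in> X n \<and> b \<in> X n \<and> d n 0 a = d n i b} \<and>
     bij_betw (\<lambda>x. (d (n + 1) i x, d (n + 1) (n + 1) x)) (X (n + 1))
       {(a, b). a \<in> X n \<and> b \<in> X n \<and> d n n a = d n i b})"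

text \<open>Tuples \<open>(x_0, \<dots>, x_n)\<close> are lists of length \<open>n + 1\<close>.\<close>

definition simplex_set ::
  "'a set \<Rightarrow> ('a \<Rightarrow> 'a \<Rightarrow> 'a option) \<Rightarrow> 'a \<Rightarrow> 'a \<Rightarrow> nat \<Rightarrow> 'a list set" where
  "simplex_set M mul e L n =
     {xs. length xs = n + 1 \<and> set xs \<subseteq> M \<and> pprod mul e xs = Some L}"

text \<open>
  The product of the \<open>x_j\<close> over \<open>j \<in> f\<^sup>-\<^sup>1(i)\<close>, taken in increasing order of \<open>j\<close>
  (the order is immaterial in the commutative case).
\<close>

definition fibre_prod ::
  "('a \<Rightarrow> 'a \<Rightarrow> 'a option) \<Rightarrow> 'a \<Rightarrow> nat \<Rightarrow> (nat \<Rightarrow> nat) \<Rightarrow> 'a list \<Rightarrow> nat \<Rightarrow> 'a option" where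
  "fibre_prod mul e m f xs i = pprod mul e (map (\<lambda>j. xs ! j) (filter (\<lambda>j. f j = i) [0..<m + 1]))"

text \<open>
  If some fibre product were undefined, \<open>the None\<close> would be an arbitrary value; definedness
  therefore has to be asserted separately.
\<close>

definition simplex_map ::
  "'a set \<Rightarrow> ('a \<Rightarrow> 'a \<Rightarrow> 'a option) \<Rightarrow> 'a \<Rightarrow> 'a \<Rightarrow>
    nat \<Rightarrow> nat \<Rightarrow> (nat \<Rightarrow> nat) \<Rightarrow> 'a list \<Rightarrow> 'a list" where
  "simplex_map M mul e L m n f =
     (\<lambda>xs\<in>simplex_set M mul e L m. map (\<lambda>i. the (fibre_prod mul e m f xs i)) [0..<n + 1])"

end

theory Submission
  imports Defs "HOL-Algebra.FiniteProduct"
begin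

text \<open>
  Adjoining an absorbing element \<open>None\<close> for ``undefined'' turns a commutative partial monoid into
  an honest commutative monoid, in which products over finite sets are available. Products over
  the fibres of a map then compose, which gives functoriality, and a factor of a defined product is
  defined. The 2-Segal maps come from commuting squares of surjections in \<open>\<Phi>\<close> for which over every
  point of the final corner one of the two initial maps is injective and the opposite final map has
  a one-point fibre; the unique lift of a compatible pair \<open>(a, b)\<close> takes its coordinates from \<open>a\<close>
  or \<open>b\<close> accordingly.
\<close>

section \<open>Adjoining a zero to the partial monoid\<close>

definition zero_adjoined :: "'a set \<Rightarrow> ('a \<Rightarrow> 'a \<Rightarrow> 'a option) \<Rightarrow> 'a \<Rightarrow> 'a option monoid" where
  "zero_adjoined M mul e =
     \<lparr>carrier = insert None (Some ` M),
      mult = (\<lambda>a b. Option.bind a (\<lambda>x. Option.bind b (mul x))),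
      one = Some e\<rparr>"

section \<open>Morphisms and face maps of \<Phi>\<close>

lemma Phi_hom_le: "f \<in> Phi_hom m n \<Longrightarrow> j \<le> m \<Longrightarrow> f j \<le> n"
  by (auto simp: Phi_hom_def)

lemma Phi_face_apply:
  "k \<le> n \<Longrightarrow> Phi_face n i k =
    (if i < n then if k \<le> i then k else k - 1 else if k < n then k else 0)"
  by (simp add: Phi_face_def)

lemma Phi_face_in_Phi_hom: "0 < n \<Longrightarrow> i \<le> n \<Longrightarrow> Phi_face n i \<in> Phi_hom n (n - 1)"
  by (auto simp: Phi_face_def Phi_hom_def)

lemma Phi_face_surj:
  assumes "0 < n" "i \<le> n"
  shows "Phi_face n i ` {..n} = {..n - 1}"
proof
  show "Phi_face n i ` {..n} \<subseteq> {..n - 1}"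
    using Phi_face_in_Phi_hom[OF assms] by (auto simp: Phi_hom_def)
  show "{..n - 1} \<subseteq> Phi_face n i ` {..n}"
  proof
    fix k assume "k \<in> {..n - 1}"
    \<comment> \<open>A section of the face map, skipping the index \<open>i + 1\<close>. For
      \<open>i = n\<close> the first branch always applies, as \<open>k < n\<close>.\<close>
    then have "Phi_face n i (if k \<le> i then k else k + 1) = k"
      "(if k \<le> i then k else k + 1) \<in> {..n}"
      using assms by (auto simp: Phi_face_def)
    then show "k \<in> Phi_face n i ` {..n}" by (metis imageI)
  qed
qed

section \<open>Products over finite index sets\<close>

context comm_partial_monoid
begin

abbreviation (input) G where "G \<equiv> zero_adjoined M mul e"
abbreviation (input) X where "X \<equiv> simplex_set M mul e"
abbreviation (input) pushforward where "pushforward \<equiv> simplex_map M mul e"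

text \<open>Option equality in \<open>mul_assoc\<close> and \<open>mul_comm\<close> already covers
  undefined products of elements of \<open>M\<close>; a factor \<open>None\<close> makes both sides
  of each law \<open>None\<close>.\<close>

lemma comm_monoid_zero_adjoined: "comm_monoid G"
proof (rule comm_monoidI)
  fix a b c assume "a \<in> carrier G" "b \<in> carrier G" "c \<in> carrier G"
  then show "a \<otimes>\<^bsub>G\<^esub> b \<otimes>\<^bsub>G\<^esub> c = a \<otimes>\<^bsub>G\<^esub> (b \<otimes>\<^bsub>G\<^esub> c)"
    using mul_assoc by (auto simp: zero_adjoined_def)
next
  fix a b assume "a \<in> carrier G" "b \<in> carrier G"
  then show "a \<otimes>\<^bsub>G\<^esub> b \<in> carrier G"
    by (cases "a \<otimes>\<^bsub>G\<^esub> b") (auto simp: zero_adjoined_def bind_eq_Some_conv intro: mul_closed)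
next
  fix a b assume "a \<in> carrier G" "b \<in> carrier G"
  then show "a \<otimes>\<^bsub>G\<^esub> b = b \<otimes>\<^bsub>G\<^esub> a"
    using mul_comm by (auto simp: zero_adjoined_def)
qed (auto simp: zero_adjoined_def unit_closed unit_left)

interpretation G: comm_monoid G
  by (rule comm_monoid_zero_adjoined)

lemma Some_in_carrier [simp]: "Some x \<in> carrier G \<longleftrightarrow> x \<in> M"
  by (auto simp: zero_adjoined_def)

text \<open>Each step of the recursion of \<open>pprod\<close> is a multiplication in
  \<open>G\<close>. Indexing by distinct positions, not by entries, keeps repeated entries apart
  while the order is forgotten.\<close>

lemma pprod_eq_finprod:
  assumes "distinct js" "\<And>j. j \<in> set js \<Longrightarrow> x j \<in> M"
  shows "pprod mul e (map x js) = (\<Otimes>\<^bsub>G\<^esub>j\<in>set js. Some (x j))"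
  using assms
proof (induction js)
  case Nil
  have "\<one>\<^bsub>G\<^esub> = Some e" by (simp add: zero_adjoined_def)
  then show ?case by simp
next
  case (Cons j js)
  then have "(\<Otimes>\<^bsub>G\<^esub>j\<in>insert j (set js). Some (x j))
      = Some (x j) \<otimes>\<^bsub>G\<^esub> (\<Otimes>\<^bsub>G\<^esub>j\<in>set js. Some (x j))"
    by (intro G.finprod_insert) auto
  also have "\<dots> = Option.bind (\<Otimes>\<^bsub>G\<^esub>j\<in>set js. Some (x j)) (mul (x j))"
    by (simp add: zero_adjoined_def)
  finally show ?case using Cons by simp
qed

text \<open>The fibres partition \<open>A\<close>; points of \<open>B\<close> outside the image
  contribute an empty product. Both the preservation of \<open>L\<close> and functoriality rest on
  this regrouping.\<close>

lemma finprod_fibres: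
  assumes "finite A" "finite B" "\<phi> \<in> A \<rightarrow> B" "x \<in> A \<rightarrow> carrier G"
  shows "(\<Otimes>\<^bsub>G\<^esub>b\<in>B. \<Otimes>\<^bsub>G\<^esub>j\<in>{j \<in> A. \<phi> j = b}. x j) = (\<Otimes>\<^bsub>G\<^esub>j\<in>A. x j)"
proof -
  have "A = (\<Union>b\<in>B. {j \<in> A. \<phi> j = b})" using assms(3) by auto
  then have "(\<Otimes>\<^bsub>G\<^esub>j\<in>A. x j) = (\<Otimes>\<^bsub>G\<^esub>j\<in>(\<Union>b\<in>B. {j \<in> A. \<phi> j = b}). x j)" by simp
  also have "\<dots> = (\<Otimes>\<^bsub>G\<^esub>b\<in>B. \<Otimes>\<^bsub>G\<^esub>j\<in>{j \<in> A. \<phi> j = b}. x j)"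
    using assms by (intro G.finprod_UN_disjoint) (auto simp: pairwise_def disjnt_def)
  finally show ?thesis by simp
qed

text \<open>The product over \<open>A\<close> has the product over \<open>B\<close> as a factor, and
  \<open>None\<close> is absorbing.\<close>

lemma finprod_subset_defined:
  assumes "finite A" "B \<subseteq> A" "x \<in> A \<rightarrow> carrier G" "(\<Otimes>\<^bsub>G\<^esub>j\<in>A. x j) \<noteq> None"
  shows "(\<Otimes>\<^bsub>G\<^esub>j\<in>B. x j) \<noteq> None"
proof
  assume None: "(\<Otimes>\<^bsub>G\<^esub>j\<in>B. x j) = None"
  have "A = B \<union> (A - B)" using assms(2) by auto
  then have "(\<Otimes>\<^bsub>G\<^esub>j\<in>A. x j) = (\<Otimes>\<^bsub>G\<^esub>j\<in>B \<union> (A - B). x j)" by simp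
  also have "\<dots> = (\<Otimes>\<^bsub>G\<^esub>j\<in>B. x j) \<otimes>\<^bsub>G\<^esub> (\<Otimes>\<^bsub>G\<^esub>j\<in>A - B. x j)"
    using assms finite_subset by (intro G.finprod_Un_disjoint) auto
  also have "\<dots> = None" unfolding None by (simp add: zero_adjoined_def)
  finally show False using assms(4) by simp
qed

section \<open>Simplex sets and fibre products in terms of coordinates\<close>

lemma simplex_set_iff:
  "xs \<in> X L n \<longleftrightarrow>
     length xs = n + 1 \<and> (\<forall>j\<le>n. xs ! j \<in> M) \<and> (\<Otimes>\<^bsub>G\<^esub>j\<in>{..n}. Some (xs ! j)) = Some L"
proof (cases "length xs = n + 1 \<and> (\<forall>j\<le>n. xs ! j \<in> M)")
  case True
  have "pprod mul e (map ((!) xs) [0..<n + 1]) = (\<Otimes>\<^bsub>G\<^esub>j\<in>set [0..<n + 1]. Some (xs ! j))"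
    using True by (intro pprod_eq_finprod) auto
  moreover have "map ((!) xs) [0..<n + 1] = xs"
    using True map_nth[of xs] by simp
  moreover have "set [0..<n + 1] = {..n}" by auto
  ultimately show ?thesis
    using True by (auto simp: simplex_set_def set_conv_nth less_Suc_eq_le)
next
  case False
  then show ?thesis using nth_mem[of _ xs] by (force simp: simplex_set_def)
qed

lemma fibre_prod_eq_finprod:
  assumes "xs \<in> X L m"
  shows "fibre_prod mul e m f xs i = (\<Otimes>\<^bsub>G\<^esub>j\<in>{j \<in> {..m}. f j = i}. Some (xs ! j))"
proof -
  have "set (filter (\<lambda>j. f j = i) [0..<m + 1]) = {j \<in> {..m}. f j = i}"
    by (auto simp: less_Suc_eq_le simp del: upt_Suc)
  then show ?thesis unfolding fibre_prod_def
    using pprod_eq_finprod[of "filter (\<lambda>j. f j = i) [0..<m + 1]" "\<lambda>j. xs ! j"] assms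
    by (simp add: simplex_set_iff)
qed

text \<open>A fibre is a subset of \<open>{..m}\<close>, over which the product is
  \<open>Some L\<close>. Thus \<open>the\<close> in \<open>simplex_map\<close> never meets
  \<open>None\<close>.\<close>

lemma fibre_prod_defined:
  assumes "xs \<in> X L m"
  shows "fibre_prod mul e m f xs i \<noteq> None"
  unfolding fibre_prod_eq_finprod[OF assms]
proof (rule finprod_subset_defined)
  show "(\<lambda>j. Some (xs ! j)) \<in> {..m} \<rightarrow> carrier G"
    using assms by (auto simp: simplex_set_iff)
  show "(\<Otimes>\<^bsub>G\<^esub>j\<in>{..m}. Some (xs ! j)) \<noteq> None"
    using assms by (simp add: simplex_set_iff)
qed auto

section \<open>Pushforward along maps and functoriality\<close>

lemma length_pushforward:
  "xs \<in> X L m \<Longrightarrow> length (pushforward L m n f xs) = n + 1"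
  by (simp add: simplex_map_def)

lemma pushforward_nth:
  assumes "xs \<in> X L m" "i \<le> n"
  shows "Some (pushforward L m n f xs ! i) = (\<Otimes>\<^bsub>G\<^esub>j\<in>{j \<in> {..m}. f j = i}. Some (xs ! j))"
proof -
  have "pushforward L m n f xs ! i = the (fibre_prod mul e m f xs i)"
    using assms by (simp add: simplex_map_def del: upt_Suc)
  then show ?thesis
    using fibre_prod_defined[OF assms(1), of f i]
    by (simp add: fibre_prod_eq_finprod[OF assms(1)])
qed

lemma pushforward_eqI:
  assumes "xs \<in> X L m" "length ys = n + 1"
    and "\<And>i. i \<le> n \<Longrightarrow> (\<Otimes>\<^bsub>G\<^esub>j\<in>{j \<in> {..m}. f j = i}. Some (xs ! j)) = Some (ys ! i)"
  shows "pushforward L m n f xs = ys"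
proof (rule nth_equalityI)
  show "length (pushforward L m n f xs) = length ys"
    using assms by (simp add: length_pushforward)
  fix i assume "i < length (pushforward L m n f xs)"
  then have "i \<le> n" using assms by (simp add: length_pushforward)
  then show "pushforward L m n f xs ! i = ys ! i"
    using pushforward_nth[OF assms(1), of i n f] assms(3)[of i] by simp
qed

text \<open>Regrouping the factors by the fibres of \<open>f\<close> leaves the total product
  \<open>L\<close> unchanged.\<close>

lemma pushforward_closed:
  assumes f: "f \<in> Phi_hom m n" and xs: "xs \<in> X L m"
  shows "pushforward L m n f xs \<in> X L n"
proof -
  let ?ys = "pushforward L m n f xs"
  have M: "(\<lambda>j. Some (xs ! j)) \<in> {..m} \<rightarrow> carrier G"
    using xs by (auto simp: simplex_set_iff)
  have fib: "Some (?ys ! i) = (\<Otimes>\<^bsub>G\<^esub>j\<in>{j \<in> {..m}. f j = i}. Some (xs ! j))" if "i \<le> n" for i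
    by (rule pushforward_nth[OF xs that])
  have closed: "?ys ! i \<in> M" if "i \<le> n" for i
  proof -
    have "(\<Otimes>\<^bsub>G\<^esub>j\<in>{j \<in> {..m}. f j = i}. Some (xs ! j)) \<in> carrier G"
      using M by (intro G.finprod_closed) auto
    \<comment> \<open>Membership in the carrier alone allows \<open>None\<close>; \<open>fib\<close>
      shows that the product is of the form \<open>Some\<close>.\<close>
    then show ?thesis using fib[OF that] by (metis Some_in_carrier)
  qed
  have "(\<Otimes>\<^bsub>G\<^esub>i\<in>{..n}. Some (?ys ! i))
      = (\<Otimes>\<^bsub>G\<^esub>i\<in>{..n}. \<Otimes>\<^bsub>G\<^esub>j\<in>{j \<in> {..m}. f j = i}. Some (xs ! j))"
    using fib M by (intro G.finprod_cong') (auto intro!: G.finprod_closed)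
  also have "\<dots> = (\<Otimes>\<^bsub>G\<^esub>j\<in>{..m}. Some (xs ! j))"
    using f M by (intro finprod_fibres) (auto simp: Phi_hom_def)
  finally show ?thesis
    using xs closed length_pushforward[OF xs] by (simp add: simplex_set_iff)
qed

lemma pushforward_id: "pushforward L n n (\<lambda>k\<in>{..n}. k) = (\<lambda>xs\<in>X L n. xs)"
proof
  fix xs
  show "pushforward L n n (\<lambda>k\<in>{..n}. k) xs = (\<lambda>xs\<in>X L n. xs) xs"
  proof (cases "xs \<in> X L n")
    case True
    have "pushforward L n n (\<lambda>k\<in>{..n}. k) xs = xs"
    proof (rule pushforward_eqI[OF True])
      show "length xs = n + 1" using True by (simp add: simplex_set_iff)
      fix i assume i: "i \<le> n"
      then have "{j \<in> {..n}. (\<lambda>k\<in>{..n}. k) j = i} = {i}" by auto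
      moreover have "xs ! i \<in> M" using True i by (simp add: simplex_set_iff)
      ultimately show "(\<Otimes>\<^bsub>G\<^esub>j\<in>{j \<in> {..n}. (\<lambda>k\<in>{..n}. k) j = i}. Some (xs ! j))
          = Some (xs ! i)"
        by simp
    qed
    then show ?thesis using True by simp
  qed (simp add: simplex_map_def)
qed

text \<open>The fibre of the composite over \<open>i\<close> is the disjoint union of the fibres of
  \<open>f\<close> over the points of the fibre of \<open>g\<close> over \<open>i\<close>, so both
  sides multiply the same entries.\<close>

lemma pushforward_compose:
  assumes f: "f \<in> Phi_hom l m" and g: "g \<in> Phi_hom m n"
  shows "pushforward L l n (compose {..l} g f)
    = compose (X L l) (pushforward L m n g) (pushforward L l m f)"
proof
  fix xs
  show "pushforward L l n (compose {..l} g f) xs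
    = compose (X L l) (pushforward L m n g) (pushforward L l m f) xs"
  proof (cases "xs \<in> X L l")
    case xs: True
    let ?ys = "pushforward L l m f xs"
    have M: "(\<lambda>j. Some (xs ! j)) \<in> {..l} \<rightarrow> carrier G"
      using xs by (auto simp: simplex_set_iff)
    have ys: "?ys \<in> X L m" by (rule pushforward_closed[OF f xs])
    have "pushforward L l n (compose {..l} g f) xs = pushforward L m n g ?ys"
    proof (rule pushforward_eqI[OF xs])
      show "length (pushforward L m n g ?ys) = n + 1" by (rule length_pushforward[OF ys])
      fix i assume i: "i \<le> n"
      let ?A = "{j \<in> {..l}. compose {..l} g f j = i}" and ?B = "{k \<in> {..m}. g k = i}"
      have "Some (pushforward L m n g ?ys ! i) = (\<Otimes>\<^bsub>G\<^esub>k\<in>?B. Some (?ys ! k))"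
        by (rule pushforward_nth[OF ys i])
      also have "\<dots> = (\<Otimes>\<^bsub>G\<^esub>k\<in>?B. \<Otimes>\<^bsub>G\<^esub>j\<in>{j \<in> ?A. f j = k}. Some (xs ! j))"
      proof (rule G.finprod_cong')
        fix k assume k: "k \<in> ?B"
        then have "{j \<in> ?A. f j = k} = {j \<in> {..l}. f j = k}" by (auto simp: compose_def)
        then show "Some (?ys ! k) = (\<Otimes>\<^bsub>G\<^esub>j\<in>{j \<in> ?A. f j = k}. Some (xs ! j))"
          using pushforward_nth[OF xs, of k m f] k by simp
      qed (use M in \<open>auto intro!: G.finprod_closed\<close>)
      also have "\<dots> = (\<Otimes>\<^bsub>G\<^esub>j\<in>?A. Some (xs ! j))"
        using f M by (intro finprod_fibres) (auto simp: Phi_hom_def compose_def)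
      finally show "(\<Otimes>\<^bsub>G\<^esub>j\<in>?A. Some (xs ! j)) = Some (pushforward L m n g ?ys ! i)" by simp
    qed
    then show ?thesis using xs by (simp add: compose_def)
  qed (simp add: simplex_map_def compose_def)
qed

lemma cosymmetric_set_simplex_set: "cosymmetric_set (X L) (pushforward L)"
proof -
  have "pushforward L m n f \<in> X L m \<rightarrow>\<^sub>E X L n" if "f \<in> Phi_hom m n" for m n f
  proof (rule PiE_I)
    fix xs assume "xs \<notin> X L m"
    then show "pushforward L m n f xs = undefined" by (simp add: simplex_map_def)
  qed (rule pushforward_closed[OF that])
  then show ?thesis
    unfolding cosymmetric_set_def using pushforward_id pushforward_compose by blast
qed

section \<open>Commuting squares in \<Phi> and fibre products of simplex sets\<close>

text \<open>Where \<open>P\<close> holds, the fibre of \<open>f\<close> is a single point and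
  \<open>x\<close> copies \<open>a\<close> there. Elsewhere \<open>g\<close> carries the fibre of
  \<open>f\<close> over \<open>u\<close> bijectively onto the fibre of \<open>k\<close> over
  \<open>h u\<close>, so its product is an entry of the pushforward of \<open>b\<close>; by
  compatibility this is an entry of the pushforward of \<open>a\<close>, which equals
  \<open>a ! u\<close> because \<open>h\<close> has a one-point fibre.\<close>

lemma lift_projection:
  assumes f: "f \<in> Phi_hom m p" and g: "g \<in> Phi_hom m q"
    and h: "h \<in> Phi_hom p r" and k: "k \<in> Phi_hom q r"
    and comm: "\<And>j. j \<le> m \<Longrightarrow> h (f j) = k (g j)"
    and f_surj: "f ` {..m} = {..p}" and g_surj: "g ` {..m} = {..q}"
    and inj: "\<And>i j. \<lbrakk>i \<le> m; j \<le> m; P (h (f j)); f i = f j\<rbrakk> \<Longrightarrow> i = j"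
    and inj': "\<And>i j. \<lbrakk>i \<le> m; j \<le> m; \<not> P (h (f j)); g i = g j\<rbrakk> \<Longrightarrow> i = j"
    and single: "\<And>u v. \<lbrakk>u \<le> p; v \<le> p; \<not> P (h v); h u = h v\<rbrakk> \<Longrightarrow> u = v"
    and a: "a \<in> X L p" and b: "b \<in> X L q"
    and ab: "pushforward L p r h a = pushforward L q r k b"
    and x: "\<And>j. j \<le> m \<Longrightarrow> x j = (if P (h (f j)) then a ! f j else b ! g j)"
    and u: "u \<le> p"
  shows "(\<Otimes>\<^bsub>G\<^esub>j\<in>{j \<in> {..m}. f j = u}. Some (x j)) = Some (a ! u)"
proof -
  obtain i where i: "i \<le> m" "f i = u" using u f_surj by (metis atMost_iff imageE)
  have aM: "a ! v \<in> M" if "v \<le> p" for v using a that by (auto simp: simplex_set_iff)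
  have bM: "b ! v \<in> M" if "v \<le> q" for v using b that by (auto simp: simplex_set_iff)
  have hu: "h u \<le> r" by (rule Phi_hom_le[OF h u])
  show ?thesis
  proof (cases "P (h u)")
    case True
    then have "{j \<in> {..m}. f j = u} = {i}" using i inj by auto
    then show ?thesis using i True x aM u by simp
  next
    case False
    let ?A = "{j \<in> {..m}. f j = u}" and ?C = "{v \<in> {..q}. k v = h u}"
    have hfib: "{v \<in> {..p}. h v = h u} = {u}" using u single False by auto
    \<comment> \<open>Only \<open>u\<close> lies over \<open>h u\<close>, so the fibre of
      \<open>f\<close> over \<open>u\<close> is a whole fibre of the composite and can be described
      through \<open>g\<close>.\<close>
    have A: "j \<in> ?A \<longleftrightarrow> j \<le> m \<and> k (g j) = h u" for j
      using comm[of j] single[of "f j" u] Phi_hom_le[OF f, of j] u False by auto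
    have "?C = g ` ?A"
    proof
      show "?C \<subseteq> g ` ?A"
      proof
        fix v assume v: "v \<in> ?C"
        then have "v \<in> g ` {..m}" using g_surj by simp
        then obtain j where "j \<le> m" "g j = v" by auto
        then show "v \<in> g ` ?A" using A[of j] v by auto
      qed
      show "g ` ?A \<subseteq> ?C" using A g_surj by auto
    qed
    have inj_g: "inj_on g ?A" using inj' False by (auto intro!: inj_onI)
    have "(\<Otimes>\<^bsub>G\<^esub>j\<in>?A. Some (x j)) = (\<Otimes>\<^bsub>G\<^esub>j\<in>?A. Some (b ! g j))"
      using x bM False Phi_hom_le[OF g] by (intro G.finprod_cong') auto
    also have "\<dots> = (\<Otimes>\<^bsub>G\<^esub>v\<in>g ` ?A. Some (b ! v))"
      using inj_g bM Phi_hom_le[OF g] by (intro G.finprod_reindex[symmetric]) auto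
    also have "\<dots> = Some (pushforward L q r k b ! h u)"
      using pushforward_nth[OF b hu] \<open>?C = g ` ?A\<close> by simp
    \<comment> \<open>Compatibility of the pair carries the entry over from \<open>b\<close> to
      \<open>a\<close>.\<close>
    also have "\<dots> = Some (pushforward L p r h a ! h u)" by (simp add: ab)
    also have "\<dots> = (\<Otimes>\<^bsub>G\<^esub>v\<in>{u}. Some (a ! v))"
      using pushforward_nth[OF a hu] hfib by simp
    also have "\<dots> = Some (a ! u)" using aM u by simp
    finally show ?thesis .
  qed
qed

text \<open>Every entry of a tuple can be read off from one of its two pushforwards, along
  \<open>f\<close> where \<open>P\<close> holds and along \<open>g\<close> elsewhere; this gives
  injectivity and dictates the lift. The one-point fibres of \<open>h\<close> and \<open>k\<close>
  make the lift project to both \<open>a\<close> and \<open>b\<close>.\<close>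

lemma bij_betw_square:
  assumes f: "f \<in> Phi_hom m p" and g: "g \<in> Phi_hom m q"
    and h: "h \<in> Phi_hom p r" and k: "k \<in> Phi_hom q r"
    and comm: "\<And>j. j \<le> m \<Longrightarrow> h (f j) = k (g j)"
    and f_surj: "f ` {..m} = {..p}" and g_surj: "g ` {..m} = {..q}"
    and inj_f: "\<And>i j. \<lbrakk>i \<le> m; j \<le> m; P (h (f j)); f i = f j\<rbrakk> \<Longrightarrow> i = j"
    and inj_g: "\<And>i j. \<lbrakk>i \<le> m; j \<le> m; \<not> P (h (f j)); g i = g j\<rbrakk> \<Longrightarrow> i = j"
    and single_h: "\<And>u v. \<lbrakk>u \<le> p; v \<le> p; \<not> P (h v); h u = h v\<rbrakk> \<Longrightarrow> u = v"
    and single_k: "\<And>u v. \<lbrakk>u \<le> q; v \<le> q; P (k v); k u = k v\<rbrakk> \<Longrightarrow> u = v"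
  shows "bij_betw (\<lambda>x. (pushforward L m p f x, pushforward L m q g x)) (X L m)
    {(a, b). a \<in> X L p \<and> b \<in> X L q \<and> pushforward L p r h a = pushforward L q r k b}"
proof (rule bij_betw_imageI)
  show "inj_on (\<lambda>x. (pushforward L m p f x, pushforward L m q g x)) (X L m)"
  proof (rule inj_onI)
    fix x y assume x: "x \<in> X L m" and y: "y \<in> X L m"
      and eq: "(pushforward L m p f x, pushforward L m q g x)
        = (pushforward L m p f y, pushforward L m q g y)"
    show "x = y"
    proof (rule nth_equalityI)
      show "length x = length y" using x y by (simp add: simplex_set_iff)
      fix j assume "j < length x"
      then have j: "j \<le> m" using x by (simp add: simplex_set_iff)
      have M: "x ! j \<in> M" "y ! j \<in> M" using x y j by (auto simp: simplex_set_iff)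
      show "x ! j = y ! j"
      proof (cases "P (h (f j))")
        case True
        have fj: "f j \<le> p" by (rule Phi_hom_le[OF f j])
        have "{i \<in> {..m}. f i = f j} = {j}" using inj_f True j by auto
        then show ?thesis
          using pushforward_nth[OF x fj, of f] pushforward_nth[OF y fj, of f] eq M by simp
      next
        case False
        have gj: "g j \<le> q" by (rule Phi_hom_le[OF g j])
        have "{i \<in> {..m}. g i = g j} = {j}" using inj_g False j by auto
        then show ?thesis
          using pushforward_nth[OF x gj, of g] pushforward_nth[OF y gj, of g] eq M by simp
      qed
    qed
  qed
next
  \<comment> \<open>Both paths around the square are one morphism, so by functoriality the image
    consists of compatible pairs.\<close>
  have comp: "compose {..m} h f = compose {..m} k g"
    using comm by (auto simp: compose_def restrict_def)
  have "pushforward L p r h (pushforward L m p f x) = pushforward L q r k (pushforward L m q g x)"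
    if "x \<in> X L m" for x
    using fun_cong[OF pushforward_compose[OF f h], of L x]
      fun_cong[OF pushforward_compose[OF g k], of L x] comp that
    by (simp add: compose_def)
  then have "(\<lambda>x. (pushforward L m p f x, pushforward L m q g x)) ` X L m
    \<subseteq> {(a, b). a \<in> X L p \<and> b \<in> X L q \<and> pushforward L p r h a = pushforward L q r k b}"
    using pushforward_closed f g by auto
  moreover have "(a, b) \<in> (\<lambda>x. (pushforward L m p f x, pushforward L m q g x)) ` X L m"
    if a: "a \<in> X L p" and b: "b \<in> X L q"
      and ab: "pushforward L p r h a = pushforward L q r k b" for a b
  proof -
    \<comment> \<open>By the injectivity argument no other tuple can project to \<open>a\<close> and
      \<open>b\<close>.\<close>
    define x where "x = map (\<lambda>j. if P (h (f j)) then a ! f j else b ! g j) [0..<m + 1]"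
    have x: "x ! j = (if P (h (f j)) then a ! f j else b ! g j)" if "j \<le> m" for j
      using that by (simp add: x_def del: upt_Suc)
    have fx: "(\<Otimes>\<^bsub>G\<^esub>j\<in>{j \<in> {..m}. f j = u}. Some (x ! j)) = Some (a ! u)" if "u \<le> p" for u
      using lift_projection[OF f g h k comm f_surj g_surj inj_f inj_g single_h a b ab x that] .
    have gx: "(\<Otimes>\<^bsub>G\<^esub>j\<in>{j \<in> {..m}. g j = u}. Some (x ! j)) = Some (b ! u)" if "u \<le> q" for u
      \<comment> \<open>The two sides of the square exchange roles and \<open>P\<close> is negated;
        \<open>comm\<close> turns the case distinction on \<open>h (f j)\<close> into one on
        \<open>k (g j)\<close>.\<close>
      by (rule lift_projection[OF g f k h comm[symmetric] g_surj f_surj, where P = "\<lambda>c. \<not> P c"])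
        (use inj_f inj_g single_k a b ab x that comm in auto)
    have xM: "(\<lambda>j. Some (x ! j)) \<in> {..m} \<rightarrow> carrier G"
      using x a b Phi_hom_le[OF f] Phi_hom_le[OF g] by (auto simp: simplex_set_iff)
    \<comment> \<open>The total product is \<open>L\<close> because the products over the fibres of
      \<open>f\<close> are the entries of \<open>a\<close>.\<close>
    have "(\<Otimes>\<^bsub>G\<^esub>j\<in>{..m}. Some (x ! j))
        = (\<Otimes>\<^bsub>G\<^esub>u\<in>{..p}. \<Otimes>\<^bsub>G\<^esub>j\<in>{j \<in> {..m}. f j = u}. Some (x ! j))"
      using f xM by (intro finprod_fibres[symmetric]) (auto simp: Phi_hom_def)
    also have "\<dots> = (\<Otimes>\<^bsub>G\<^esub>u\<in>{..p}. Some (a ! u))"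
      using fx a by (intro G.finprod_cong') (auto simp: simplex_set_iff)
    also have "\<dots> = Some L" using a by (simp add: simplex_set_iff)
    finally have "(\<Otimes>\<^bsub>G\<^esub>j\<in>{..m}. Some (x ! j)) = Some L" .
    moreover have "length x = m + 1" by (simp add: x_def)
    ultimately have xX: "x \<in> X L m"
      using xM by (auto simp: simplex_set_iff)
    have "pushforward L m p f x = a"
      using xX fx a by (intro pushforward_eqI) (auto simp: simplex_set_iff)
    moreover have "pushforward L m q g x = b"
      using xX gx b by (intro pushforward_eqI) (auto simp: simplex_set_iff)
    ultimately show ?thesis using xX by force
  qed
  ultimately show "(\<lambda>x. (pushforward L m p f x, pushforward L m q g x)) ` X L m
    = {(a, b). a \<in> X L p \<and> b \<in> X L q \<and> pushforward L p r h a = pushforward L q r k b}"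
    by auto
qed

section \<open>The 2-Segal property\<close>

text \<open>
  The two face maps on \<open>[n + 1]\<close> merge disjoint pairs of vertices, and the pair merged by the
  outer one (\<open>d\<^sub>0\<close> or \<open>d\<^sub>n\<^sub>+\<^sub>1\<close>) is the fibre over \<open>0\<close>; hence the choice of \<open>P\<close>.
\<close>

lemma two_segal_simplex_set: "two_segal (X L) (face (pushforward L))"
proof -
  have hom: "Phi_face (Suc n) i \<in> Phi_hom (Suc n) n" if "i \<le> Suc n" for n i
    using Phi_face_in_Phi_hom[of "Suc n" i] that by simp
  have "bij_betw (\<lambda>x. (face (pushforward L) (n + 1) (i + 1) x, face (pushforward L) (n + 1) 0 x))
      (X L (n + 1))
      {(a, b). a \<in> X L n \<and> b \<in> X L n \<and> face (pushforward L) n 0 a = face (pushforward L) n i b}"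
    if "0 < i" "i < n" for n i
    unfolding face_def add_diff_cancel_right'
    \<comment> \<open>On \<open>[n + 1]\<close> the outer face merges \<open>0\<close> and
      \<open>1\<close>, the inner one \<open>i + 1\<close> and \<open>i + 2\<close>; the pairs are
      disjoint since \<open>0 < i\<close>.\<close>
    by (rule bij_betw_square[where P = "\<lambda>c. c = 0"])
      (use that hom Phi_face_in_Phi_hom in
        \<open>auto simp: Phi_face_surj Phi_face_apply split: if_splits cong del: image_cong_simp\<close>)
  moreover have "bij_betw
      (\<lambda>x. (face (pushforward L) (n + 1) i x, face (pushforward L) (n + 1) (n + 1) x))
      (X L (n + 1))
      {(a, b). a \<in> X L n \<and> b \<in> X L n \<and> face (pushforward L) n n a = face (pushforward L) n i b}"
    if "0 < i" "i < n" for n i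
    unfolding face_def add_diff_cancel_right'
    \<comment> \<open>Now the outer face merges \<open>0\<close> and \<open>n + 1\<close>, the inner
      one \<open>i\<close> and \<open>i + 1\<close>, which lie strictly between them since
      \<open>0 < i\<close> and \<open>i < n\<close>.\<close>
    by (rule bij_betw_square[where P = "\<lambda>c. c = 0"])
      (use that hom Phi_face_in_Phi_hom in
        \<open>auto simp: Phi_face_surj Phi_face_apply split: if_splits cong del: image_cong_simp\<close>)
  ultimately show ?thesis unfolding two_segal_def by blast
qed

end

theorem mainTheorem4:
  fixes M :: "'a set" and mul :: "'a \<Rightarrow> 'a \<Rightarrow> 'a option" and e L :: 'a
  assumes "comm_partial_monoid M mul e" and "L \<in> M"
  shows "(\<forall>m n. \<forall>f\<in>Phi_hom m n. \<forall>xs\<in>simplex_set M mul e L m. \<forall>i\<le>n.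
            fibre_prod mul e m f xs i \<noteq> None) \<and>
         cosymmetric_set (simplex_set M mul e L) (simplex_map M mul e L) \<and>
         two_segal (simplex_set M mul e L) (face (simplex_map M mul e L))"
proof -
  interpret comm_partial_monoid M mul e by (rule assms(1))
  show ?thesis
    using fibre_prod_defined cosymmetric_set_simplex_set two_segal_simplex_set by blast
qed

end
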